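(* Let $R$ be a division ring and let $M_R$ be an infinite right $R$-module. Then the monoid $\overline{\mathcal X}^*(M_R)$ of non-trivial colours is isomorphic to $(\mathbb N,+)$.
   Context: A right $R$-module $M$ is a structure in the language $L_R=\langle +,-,0,\{\cdot_r:r\in R\}\rangle$ ($\cdot_r$ = right multiplication by $r$). A positive primitive (pp) formula is one of the form $\exists \bar y\,\bigwedge_j(\text{linear equation in }\bar x,\bar y)$; a subset of some $M^n$ is pp-definable if it is defined by a pp-formula with parameters from $M$, and a pp-definable bijection is a bijection between such sets whose graph is pp-definable. $\overline{\mathcal X}^*(M_R)$ is the set of equivalence classes of non-empty pp-definable subsets of finite powers of $M$ under the relation "there is a pp-definable bijection between them", made into a commutative monoid by the operation induced by Cartesian product. $\mathbb N$ includes $0$. *)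

theory Defs
  imports "HOL-Algebra.Group"
begin

locale right_module =
  fixes act :: "'m::ab_group_add \<Rightarrow> 'r::ring_1 \<Rightarrow> 'm"  (infixl \<open>\<cdot>\<close> 75)
  assumes act_add_left: "(x + y) \<cdot> r = x \<cdot> r + y \<cdot> r"
    and act_add_right: "x \<cdot> (r + s) = x \<cdot> r + x \<cdot> s"
    and act_mult: "x \<cdot> (r * s) = (x \<cdot> r) \<cdot> s"
    and act_one: "x \<cdot> 1 = x"

text \<open>Terms of the language of right modules, expanded by a constant \<open>Par c\<close> for every element
  \<open>c\<close> of the module. \<open>Free i\<close> is the variable \<open>x\<^sub>i\<close>, and \<open>Bound j\<close> is the existentially
  quantified variable \<open>y\<^sub>j\<close>.\<close>

datatype ('m, 'r) pp_term =
    Free nat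
  | Bound nat
  | Par 'm
  | Zero
  | Plus "('m, 'r) pp_term" "('m, 'r) pp_term"
  | Minus "('m, 'r) pp_term"
  | Act "('m, 'r) pp_term" 'r

primrec term_over :: "nat \<Rightarrow> nat \<Rightarrow> ('m, 'r) pp_term \<Rightarrow> bool" where
  "term_over n k (Free i) \<longleftrightarrow> i < n"
| "term_over n k (Bound j) \<longleftrightarrow> j < k"
| "term_over n k (Par c) \<longleftrightarrow> True"
| "term_over n k Zero \<longleftrightarrow> True"
| "term_over n k (Plus s t) \<longleftrightarrow> term_over n k s \<and> term_over n k t"
| "term_over n k (Minus t) \<longleftrightarrow> term_over n k t"
| "term_over n k (Act t r) \<longleftrightarrow> term_over n k t"

primrec term_val ::
  "('m::ab_group_add \<Rightarrow> 'r \<Rightarrow> 'm) \<Rightarrow> 'm list \<Rightarrow> 'm list \<Rightarrow> ('m, 'r) pp_term \<Rightarrow> 'm" where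
  "term_val act xs ys (Free i) = xs ! i"
| "term_val act xs ys (Bound j) = ys ! j"
| "term_val act xs ys (Par c) = c"
| "term_val act xs ys Zero = 0"
| "term_val act xs ys (Plus s t) = term_val act xs ys s + term_val act xs ys t"
| "term_val act xs ys (Minus t) = - term_val act xs ys t"
| "term_val act xs ys (Act t r) = act (term_val act xs ys t) r"

text \<open>\<open>PP k eqs\<close> is the formula \<open>\<exists>y\<^sub>0 \<dots> y\<^sub>k\<^sub>-\<^sub>1. \<And>(s, t) \<in> eqs. s = t\<close>.\<close>

datatype ('m, 'r) pp_formula = PP nat "(('m, 'r) pp_term \<times> ('m, 'r) pp_term) list"

primrec formula_over :: "nat \<Rightarrow> ('m, 'r) pp_formula \<Rightarrow> bool" where
  "formula_over n (PP k eqs) \<longleftrightarrow> (\<forall>(s, t) \<in> set eqs. term_over n k s \<and> term_over n k t)"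

primrec satisfies ::
  "('m::ab_group_add \<Rightarrow> 'r \<Rightarrow> 'm) \<Rightarrow> 'm list \<Rightarrow> ('m, 'r) pp_formula \<Rightarrow> bool" where
  "satisfies act xs (PP k eqs) \<longleftrightarrow>
    (\<exists>ys. length ys = k \<and> (\<forall>(s, t) \<in> set eqs. term_val act xs ys s = term_val act xs ys t))"

text \<open>The \<open>n\<close>-th power of the module is the set of lists of length \<open>n\<close>.\<close>

definition pp_definable :: "('m::ab_group_add \<Rightarrow> 'r \<Rightarrow> 'm) \<Rightarrow> nat \<Rightarrow> 'm list set \<Rightarrow> bool" where
  "pp_definable act n D \<longleftrightarrow>
    (\<exists>\<phi>. formula_over n \<phi> \<and> D = {xs. length xs = n \<and> satisfies act xs \<phi>})"

definition nonempty_pp_sets :: "('m::ab_group_add \<Rightarrow> 'r \<Rightarrow> 'm) \<Rightarrow> 'm list set set" where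
  "nonempty_pp_sets act = {D. D \<noteq> {} \<and> (\<exists>n. pp_definable act n D)}"

definition graph_on :: "('m list \<Rightarrow> 'm list) \<Rightarrow> 'm list set \<Rightarrow> 'm list set" where
  "graph_on f A = {xs @ f xs |xs. xs \<in> A}"

definition pp_bijection ::
  "('m::ab_group_add \<Rightarrow> 'r \<Rightarrow> 'm) \<Rightarrow> ('m list \<Rightarrow> 'm list) \<Rightarrow> 'm list set \<Rightarrow> 'm list set \<Rightarrow> bool" where
  "pp_bijection act f A B \<longleftrightarrow> bij_betw f A B \<and> (\<exists>n. pp_definable act n (graph_on f A))"

definition colour_rel :: "('m::ab_group_add \<Rightarrow> 'r \<Rightarrow> 'm) \<Rightarrow> ('m list set \<times> 'm list set) set" where
  "colour_rel act =
    {(A, B). A \<in> nonempty_pp_sets act \<and> B \<in> nonempty_pp_sets act \<and> (\<exists>f. pp_bijection act f A B)}"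

definition cart_prod :: "'m list set \<Rightarrow> 'm list set \<Rightarrow> 'm list set" where
  "cart_prod A B = {xs @ ys |xs ys. xs \<in> A \<and> ys \<in> B}"

text \<open>The unit is the colour of the one-point set \<open>M\<^sup>0\<close>.\<close>

definition nontrivial_colours :: "('m::ab_group_add \<Rightarrow> 'r \<Rightarrow> 'm) \<Rightarrow> 'm list set set monoid" where
  "nontrivial_colours act =
    \<lparr>carrier = nonempty_pp_sets act // colour_rel act,
     mult = (\<lambda>X Y. \<Union>A\<in>X. \<Union>B\<in>Y. colour_rel act `` {cart_prod A B}),
     one = colour_rel act `` {{[]}}\<rparr>"



primrec subst :: "(nat \<Rightarrow> ('m, 'r) pp_term) \<Rightarrow> (nat \<Rightarrow> ('m, 'r) pp_term) \<Rightarrow> ('m, 'r) pp_term \<Rightarrow> ('m, 'r) pp_term"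
  where
  "subst \<sigma> \<tau> (Free i) = \<sigma> i"
| "subst \<sigma> \<tau> (Bound j) = \<tau> j"
| "subst \<sigma> \<tau> (Par c) = Par c"
| "subst \<sigma> \<tau> Zero = Zero"
| "subst \<sigma> \<tau> (Plus s t) = Plus (subst \<sigma> \<tau> s) (subst \<sigma> \<tau> t)"
| "subst \<sigma> \<tau> (Minus t) = Minus (subst \<sigma> \<tau> t)"
| "subst \<sigma> \<tau> (Act t r) = Act (subst \<sigma> \<tau> t) r"

lemma term_over_subst:
  assumes "term_over n k t" "\<And>i. i < n \<Longrightarrow> term_over n' k' (\<sigma> i)"
    "\<And>j. j < k \<Longrightarrow> term_over n' k' (\<tau> j)"
  shows "term_over n' k' (subst \<sigma> \<tau> t)"
  using assms by (induction t) auto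

lemma term_val_subst:
  assumes "term_over n k t" "\<And>i. i < n \<Longrightarrow> term_val act xs' ys' (\<sigma> i) = xs ! i"
    "\<And>j. j < k \<Longrightarrow> term_val act xs' ys' (\<tau> j) = ys ! j"
  shows "term_val act xs' ys' (subst \<sigma> \<tau> t) = term_val act xs ys t"
  using assms by (induction t) auto

lemma pp_definable_iff:
  "pp_definable act n D \<longleftrightarrow>
    (\<exists>k eqs. (\<forall>(s, t) \<in> set eqs. term_over n k s \<and> term_over n k t) \<and>
      D = {xs. length xs = n \<and> (\<exists>ys. length ys = k \<and>
            (\<forall>(s, t) \<in> set eqs. term_val act xs ys s = term_val act xs ys t))})"
proof -
  have ex: "(\<exists>\<phi>. P \<phi>) \<longleftrightarrow> (\<exists>k eqs. P (PP k eqs))" for P :: "('a, 'b) pp_formula \<Rightarrow> bool"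
    by (metis pp_formula.exhaust)
  show ?thesis
    unfolding pp_definable_def ex by simp
qed

lemma pp_definable_length: "pp_definable act n D \<Longrightarrow> xs \<in> D \<Longrightarrow> length xs = n"
  by (auto simp: pp_definable_def)

lemma ball_map_prod_eq:
  assumes "\<forall>(s, t) \<in> set eqs. P s \<and> P t" "\<And>t. P t \<Longrightarrow> v (a t) = w t"
  shows "(\<forall>(s, t) \<in> set (map (map_prod a a) eqs). v s = v t) \<longleftrightarrow> (\<forall>(s, t) \<in> set eqs. w s = w t)"
proof -
  have "(v (a s) = v (a t)) = (w s = w t)" if "(s, t) \<in> set eqs" for s t
    using assms that by fastforce
  then have "(case map_prod a a p of (s, t) \<Rightarrow> v s = v t) = (case p of (s, t) \<Rightarrow> w s = w t)"
    if "p \<in> set eqs" for p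
    using that by (cases p) simp
  then show ?thesis by simp
qed

lemma ex_append_conv:
  "(\<exists>us. length us = a + b \<and> P us) \<longleftrightarrow>
    (\<exists>xs ys. length xs = a \<and> length ys = b \<and> P (xs @ ys))" (is "?L \<longleftrightarrow> ?R")
proof
  assume ?L
  then obtain us where "length us = a + b" "P us" by blast
  then have "length (take a us) = a" "length (drop a us) = b" "P (take a us @ drop a us)"
    by simp_all
  then show ?R by blast
next
  assume ?R
  then obtain xs ys where "length xs = a" "length ys = b" "P (xs @ ys)" by blast
  then have "length (xs @ ys) = a + b \<and> P (xs @ ys)" by simp
  then show ?L ..
qed

lemma pp_definable_Int:
  assumes "pp_definable act n A" "pp_definable act n B"
  shows "pp_definable act n (A \<inter> B)"
proof -
  obtain k eqs where A: "\<forall>(s, t) \<in> set eqs. term_over n k s \<and> term_over n k t"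
    "A = {xs. length xs = n \<and> (\<exists>ys. length ys = k \<and>
            (\<forall>(s, t) \<in> set eqs. term_val act xs ys s = term_val act xs ys t))}"
    using assms(1) unfolding pp_definable_iff by blast
  obtain l eqs' where B: "\<forall>(s, t) \<in> set eqs'. term_over n l s \<and> term_over n l t"
    "B = {xs. length xs = n \<and> (\<exists>ys. length ys = l \<and>
            (\<forall>(s, t) \<in> set eqs'. term_val act xs ys s = term_val act xs ys t))}"
    using assms(2) unfolding pp_definable_iff by blast
  let ?a = "subst Free Bound" and ?b = "subst Free (\<lambda>j. Bound (k + j))"
  let ?E = "map (map_prod ?a ?a) eqs @ map (map_prod ?b ?b) eqs'"
  have over: "\<forall>(s, t) \<in> set ?E. term_over n (k + l) s \<and> term_over n (k + l) t"
    using A(1) B(1) by (fastforce intro!: term_over_subst)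
  have va: "term_val act xs (ys @ zs) (?a t) = term_val act xs ys t"
    if "term_over n k t" "length ys = k" for xs ys zs t
    using that by (intro term_val_subst) (auto simp: nth_append)
  have vb: "term_val act xs (ys @ zs) (?b t) = term_val act xs zs t"
    if "term_over n l t" "length ys = k" for xs ys zs t
    using that by (intro term_val_subst) (auto simp: nth_append)
  have sat: "(\<forall>(s, t) \<in> set ?E. term_val act xs (ys @ zs) s = term_val act xs (ys @ zs) t) \<longleftrightarrow>
     (\<forall>(s, t) \<in> set eqs. term_val act xs ys s = term_val act xs ys t) \<and>
     (\<forall>(s, t) \<in> set eqs'. term_val act xs zs s = term_val act xs zs t)"
    if "length ys = k" for xs ys zs
    unfolding set_append ball_Un
    by (intro arg_cong2[where f = "(\<and>)"] ball_map_prod_eq[OF A(1)] ball_map_prod_eq[OF B(1)]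
        va[OF _ that] vb[OF _ that])
  have "A \<inter> B = {xs. length xs = n \<and> (\<exists>ys. length ys = k + l \<and>
            (\<forall>(s, t) \<in> set ?E. term_val act xs ys s = term_val act xs ys t))}"
    unfolding A(2) B(2) ex_append_conv using sat by blast
  with over show ?thesis
    unfolding pp_definable_iff by blast
qed

lemma pp_definable_reindex:
  assumes "pp_definable act n A" "length js = n" "set js \<subseteq> {..<m}"
  shows "pp_definable act m {zs. length zs = m \<and> map ((!) zs) js \<in> A}"
proof -
  obtain k eqs where A: "\<forall>(s, t) \<in> set eqs. term_over n k s \<and> term_over n k t"
    "A = {xs. length xs = n \<and> (\<exists>ys. length ys = k \<and>
            (\<forall>(s, t) \<in> set eqs. term_val act xs ys s = term_val act xs ys t))}"
    using assms(1) unfolding pp_definable_iff by blast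
  let ?a = "subst (\<lambda>i. Free (js ! i)) Bound"
  let ?E = "map (map_prod ?a ?a) eqs"
  have js: "js ! i < m" if "i < n" for i
    using assms(2,3) nth_mem that by blast
  have over: "\<forall>(s, t) \<in> set ?E. term_over m k s \<and> term_over m k t"
    using A(1) js by (fastforce intro!: term_over_subst)
  have va: "term_val act zs ys (?a t) = term_val act (map ((!) zs) js) ys t"
    if "term_over n k t" for zs ys t
    using that assms(2) by (intro term_val_subst) auto
  have sat: "(\<forall>(s, t) \<in> set ?E. term_val act zs ys s = term_val act zs ys t) \<longleftrightarrow>
     (\<forall>(s, t) \<in> set eqs.
        term_val act (map ((!) zs) js) ys s = term_val act (map ((!) zs) js) ys t)" for zs ys
    by (rule ball_map_prod_eq[OF A(1)]) (rule va)
  have "{zs. length zs = m \<and> map ((!) zs) js \<in> A} =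
      {xs. length xs = m \<and> (\<exists>ys. length ys = k \<and>
            (\<forall>(s, t) \<in> set ?E. term_val act xs ys s = term_val act xs ys t))}"
    unfolding A(2) using assms(2) by (simp del: set_map add: sat)
  with over show ?thesis
    unfolding pp_definable_iff by blast
qed

lemma pp_definable_proj:
  assumes "pp_definable act (n + l) A"
  shows "pp_definable act n {xs. length xs = n \<and> (\<exists>zs. length zs = l \<and> xs @ zs \<in> A)}"
proof -
  obtain k eqs where A: "\<forall>(s, t) \<in> set eqs. term_over (n + l) k s \<and> term_over (n + l) k t"
    "A = {xs. length xs = n + l \<and> (\<exists>ys. length ys = k \<and>
            (\<forall>(s, t) \<in> set eqs. term_val act xs ys s = term_val act xs ys t))}"
    using assms unfolding pp_definable_iff by blast
  let ?a = "subst (\<lambda>i. if i < n then Free i else Bound (i - n)) (\<lambda>j. Bound (l + j))"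
  let ?E = "map (map_prod ?a ?a) eqs"
  have over: "\<forall>(s, t) \<in> set ?E. term_over n (l + k) s \<and> term_over n (l + k) t"
    using A(1) by (fastforce intro!: term_over_subst)
  have va: "term_val act xs (zs @ ys) (?a t) = term_val act (xs @ zs) ys t"
    if "term_over (n + l) k t" "length xs = n" "length zs = l" for xs zs ys t
    using that by (intro term_val_subst) (auto simp: nth_append)
  have sat: "(\<forall>(s, t) \<in> set ?E. term_val act xs (zs @ ys) s = term_val act xs (zs @ ys) t) \<longleftrightarrow>
     (\<forall>(s, t) \<in> set eqs. term_val act (xs @ zs) ys s = term_val act (xs @ zs) ys t)"
    if "length xs = n" "length zs = l" for xs ys zs
    by (rule ball_map_prod_eq[OF A(1)]) (rule va[OF _ that])
  have "(\<exists>zs. length zs = l \<and> xs @ zs \<in> A) \<longleftrightarrow>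
      (\<exists>zs ys. length zs = l \<and> length ys = k \<and>
        (\<forall>(s, t) \<in> set ?E. term_val act xs (zs @ ys) s = term_val act xs (zs @ ys) t))"
    if "length xs = n" for xs
    using that by (simp add: A(2) sat[OF that] del: set_map cong: conj_cong)
  then have "{xs. length xs = n \<and> (\<exists>zs. length zs = l \<and> xs @ zs \<in> A)} =
     {xs. length xs = n \<and> (\<exists>ys. length ys = l + k \<and>
            (\<forall>(s, t) \<in> set ?E. term_val act xs ys s = term_val act xs ys t))}"
    unfolding ex_append_conv by (simp del: set_map cong: conj_cong)
  with over show ?thesis
    unfolding pp_definable_iff by blast
qed

lemma pp_definable_eq:
  assumes "set ks \<subseteq> {..<m}" "set js \<subseteq> {..<m}" "length ks = length js"
  shows "pp_definable act m {zs. length zs = m \<and> map ((!) zs) ks = map ((!) zs) js}"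
proof -
  let ?E = "map (map_prod Free Free) (zip ks js)"
  have "a < m \<and> b < m" if "(a, b) \<in> set (zip ks js)" for a b
    using set_zip_leftD[OF that] set_zip_rightD[OF that] assms by auto
  then have 1: "\<forall>(s, t) \<in> set ?E. term_over m 0 s \<and> term_over m 0 t"
    by auto
  have 2: "{zs. length zs = m \<and> map ((!) zs) ks = map ((!) zs) js} =
    {xs. length xs = m \<and> (\<exists>ys. length ys = 0 \<and>
            (\<forall>(s, t) \<in> set ?E. term_val act xs ys s = term_val act xs ys t))}"
  proof -
    have "map ((!) zs) ks = map ((!) zs) js \<longleftrightarrow>
        (\<forall>(s, t) \<in> set ?E. term_val act zs [] s = term_val act zs [] t)" for zs
      using assms(3) by (induction ks js rule: list_induct2) auto
    then show ?thesis by (simp del: set_map)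
  qed
  show ?thesis
    unfolding pp_definable_iff by (intro exI conjI) (fact 1, fact 2)
qed

lemma map_nth_upt: "b \<le> length zs \<Longrightarrow> map ((!) zs) [a..<b] = take (b - a) (drop a zs)"
  by (intro nth_equalityI) auto

lemma append_set_eqI:
  assumes "\<And>zs. zs \<in> S \<Longrightarrow> length zs = a + b" "\<And>zs. zs \<in> T \<Longrightarrow> length zs = a + b"
    and "\<And>xs ys. length xs = a \<Longrightarrow> length ys = b \<Longrightarrow> xs @ ys \<in> S \<longleftrightarrow> xs @ ys \<in> T"
  shows "S = T"
proof (intro Set.set_eqI)
  fix zs
  show "zs \<in> S \<longleftrightarrow> zs \<in> T"
  proof (cases "length zs = a + b")
    case True
    then show ?thesis
      using assms(3)[of "take a zs" "drop a zs"] by simp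
  next
    case False
    then show ?thesis using assms(1,2) by blast
  qed
qed

lemma graph_on_mem:
  assumes "pp_definable act n A" "length xs = n"
  shows "xs @ ys \<in> graph_on f A \<longleftrightarrow> xs \<in> A \<and> ys = f xs"
  using assms by (auto simp: graph_on_def dest: pp_definable_length)

lemma cart_prod_mem:
  assumes "pp_definable act n A" "length xs = n"
  shows "xs @ ys \<in> cart_prod A B \<longleftrightarrow> xs \<in> A \<and> ys \<in> B"
  using assms by (auto simp: cart_prod_def dest: pp_definable_length)

lemma graph_on_length:
  assumes "pp_definable act n A" "pp_definable act m B" "f ` A \<subseteq> B" "zs \<in> graph_on f A"
  shows "length zs = n + m"
  using assms by (force simp: graph_on_def dest: pp_definable_length)

lemma pp_bijection_graph:
  assumes "pp_bijection act f A B" "pp_definable act n A" "pp_definable act m B" "A \<noteq> {}"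
  shows "pp_definable act (n + m) (graph_on f A)"
proof -
  obtain N where N: "pp_definable act N (graph_on f A)"
    using assms(1) by (auto simp: pp_bijection_def)
  obtain x where "x \<in> A" using assms(4) by blast
  then have x: "x @ f x \<in> graph_on f A" by (auto simp: graph_on_def)
  have "f ` A \<subseteq> B" using assms(1) by (auto simp: pp_bijection_def bij_betw_def)
  with x N show ?thesis
    using graph_on_length[OF assms(2,3)] pp_definable_length[OF N] by metis
qed

lemma cart_prod_length:
  assumes "pp_definable act n A" "pp_definable act m B" "zs \<in> cart_prod A B"
  shows "length zs = n + m"
  using assms by (force simp: cart_prod_def dest: pp_definable_length)

lemma pp_definable_cart_prod:
  assumes "pp_definable act n A" "pp_definable act m B"
  shows "pp_definable act (n + m) (cart_prod A B)"
proof -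
  have "cart_prod A B =
      {zs. length zs = n + m \<and> map ((!) zs) [0..<n] \<in> A} \<inter>
      {zs. length zs = n + m \<and> map ((!) zs) [n..<n + m] \<in> B}"
    by (rule append_set_eqI[of _ n m])
      (auto simp: cart_prod_mem[OF assms(1)] map_nth_upt dest: cart_prod_length[OF assms])
  then show ?thesis
    by (auto intro!: pp_definable_Int pp_definable_reindex[OF assms(1)] pp_definable_reindex[OF assms(2)])
qed

lemma pp_bijection_id:
  assumes "pp_definable act n A"
  shows "pp_bijection act id A A"
proof -
  have "graph_on id A =
      {zs. length zs = n + n \<and> map ((!) zs) [0..<n] \<in> A} \<inter>
      {zs. length zs = n + n \<and> map ((!) zs) [0..<n] = map ((!) zs) [n..<n + n]}"
    by (rule append_set_eqI[of _ n n])
      (auto simp: graph_on_mem[OF assms] map_nth_upt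
        dest: graph_on_length[OF assms assms, of id, simplified])
  then have "pp_definable act (n + n) (graph_on id A)"
    by (auto intro!: pp_definable_Int pp_definable_reindex[OF assms] pp_definable_eq)
  then show ?thesis by (auto simp: pp_bijection_def)
qed

lemma pp_bijection_inv:
  assumes "pp_bijection act f A B" "pp_definable act n A" "pp_definable act m B" "A \<noteq> {}"
  shows "pp_bijection act (inv_into A f) B A"
proof -
  note G = pp_bijection_graph[OF assms]
  have bij: "bij_betw f A B" using assms(1) by (simp add: pp_bijection_def)
  then have bij': "bij_betw (inv_into A f) B A" by (rule bij_betw_inv_into)
  then have sub: "inv_into A f ` B \<subseteq> A" by (auto simp: bij_betw_def)
  have "graph_on (inv_into A f) B =
      {zs. length zs = m + n \<and> map ((!) zs) ([m..<m + n] @ [0..<m]) \<in> graph_on f A}"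
  proof (rule append_set_eqI[of _ m n])
    fix ys xs :: "'a list"
    assume len: "length ys = m" "length xs = n"
    have "ys \<in> B \<and> xs = inv_into A f ys \<longleftrightarrow> xs \<in> A \<and> ys = f xs"
      using bij by (metis bij_betw_apply bij_betw_inv_into_left bij_betw_inv_into_right bij')
    then show "ys @ xs \<in> graph_on (inv_into A f) B \<longleftrightarrow>
        ys @ xs \<in> {zs. length zs = m + n \<and> map ((!) zs) ([m..<m + n] @ [0..<m]) \<in> graph_on f A}"
      using len by (simp add: graph_on_mem[OF assms(2)] graph_on_mem[OF assms(3)] map_nth_upt)
  qed (auto dest: graph_on_length[OF assms(3,2) sub])
  moreover have "pp_definable act (m + n)
      {zs. length zs = m + n \<and> map ((!) zs) ([m..<m + n] @ [0..<m]) \<in> graph_on f A}"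
    by (rule pp_definable_reindex[OF G]) auto
  ultimately show ?thesis using bij' by (auto simp: pp_bijection_def)
qed

lemma pp_bijection_comp:
  assumes f: "pp_bijection act f A B" and g: "pp_bijection act g B C"
    and A: "pp_definable act n A" "A \<noteq> {}" and B: "pp_definable act m B" and C: "pp_definable act p C"
  shows "pp_bijection act (g \<circ> f) A C"
proof -
  have bf: "bij_betw f A B" and bg: "bij_betw g B C"
    using f g by (auto simp: pp_bijection_def)
  then have bij: "bij_betw (g \<circ> f) A C" by (rule bij_betw_trans)
  have fB: "f x \<in> B" if "x \<in> A" for x using bf that by (rule bij_betw_apply)
  have "B \<noteq> {}" using A(2) fB by auto
  note Gf = pp_bijection_graph[OF f A(1) B A(2)] and Gg = pp_bijection_graph[OF g B C this]
  have sub: "(g \<circ> f) ` A \<subseteq> C" using bij by (auto simp: bij_betw_def)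
  define H where "H =
    {us. length us = n + p + m \<and> map ((!) us) ([0..<n] @ [n + p..<n + p + m]) \<in> graph_on f A} \<inter>
    {us. length us = n + p + m \<and> map ((!) us) ([n + p..<n + p + m] @ [n..<n + p]) \<in> graph_on g B}"
  have H: "pp_definable act (n + p + m) H"
    unfolding H_def
    by (intro pp_definable_Int pp_definable_reindex[OF Gf] pp_definable_reindex[OF Gg]) auto
  have mem: "(xs @ ys) @ ws \<in> H \<longleftrightarrow> xs \<in> A \<and> ws = f xs \<and> ys = g ws"
    if "length xs = n" "length ys = p" "length ws = m" for xs ys ws
    using that fB by (auto simp: H_def map_nth_upt graph_on_mem[OF A(1)] graph_on_mem[OF B])
  have "graph_on (g \<circ> f) A = {zs. length zs = n + p \<and> (\<exists>ws. length ws = m \<and> zs @ ws \<in> H)}"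
  proof (rule append_set_eqI[of _ n p])
    fix xs ys :: "'a list"
    assume len: "length xs = n" "length ys = p"
    have "xs @ ys \<in> graph_on (g \<circ> f) A \<longleftrightarrow> xs \<in> A \<and> ys = g (f xs)"
      using len by (simp add: graph_on_mem[OF A(1)])
    also have "\<dots> \<longleftrightarrow> (\<exists>ws. length ws = m \<and> (xs @ ys) @ ws \<in> H)"
      using mem[OF len] fB pp_definable_length[OF B] by blast
    finally show "xs @ ys \<in> graph_on (g \<circ> f) A \<longleftrightarrow>
        xs @ ys \<in> {zs. length zs = n + p \<and> (\<exists>ws. length ws = m \<and> zs @ ws \<in> H)}"
      using len by simp
  qed (auto dest: graph_on_length[OF A(1) C sub])
  with pp_definable_proj[OF H] bij show ?thesis by (auto simp: pp_bijection_def)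
qed

lemma pp_bijection_cart_prod:
  assumes f: "pp_bijection act f A B" and g: "pp_bijection act g A' B'"
    and A: "pp_definable act n A" "A \<noteq> {}" and B: "pp_definable act m B"
    and A': "pp_definable act n' A'" "A' \<noteq> {}" and B': "pp_definable act m' B'"
  shows "pp_bijection act (\<lambda>zs. f (take n zs) @ g (drop n zs)) (cart_prod A A') (cart_prod B B')"
    (is "pp_bijection act ?h _ _")
proof -
  note Gf = pp_bijection_graph[OF f A(1) B A(2)] and Gg = pp_bijection_graph[OF g A'(1) B' A'(2)]
  have bf: "bij_betw f A B" and bg: "bij_betw g A' B'"
    using f g by (auto simp: pp_bijection_def)
  note lA = pp_definable_length[OF A(1)] and lB = pp_definable_length[OF B]
  have fB: "f x \<in> B" "length (f x) = m" if "x \<in> A" for x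
    using bij_betw_apply[OF bf that] lB by auto
  have gB: "g x \<in> B'" if "x \<in> A'" for x
    using bij_betw_apply[OF bg that] .
  have h: "?h (xs @ ys) = f xs @ g ys" if "xs \<in> A" for xs ys
    using lA[OF that] by simp
  have inj: "inj_on ?h (cart_prod A A')"
  proof (rule inj_onI)
    fix u v assume "u \<in> cart_prod A A'" "v \<in> cart_prod A A'" and eq: "?h u = ?h v"
    then obtain x y x' y' where u: "u = x @ y" "x \<in> A" "y \<in> A'" and v: "v = x' @ y'" "x' \<in> A" "y' \<in> A'"
      by (auto simp: cart_prod_def)
    have "f x = f x'" "g y = g y'"
      using eq fB(2) h[OF u(2)] h[OF v(2)] u v by (simp_all add: append_eq_append_conv)
    then show "u = v"
      using u v bf bg by (auto simp: bij_betw_def dest: inj_onD)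
  qed
  have img: "?h ` cart_prod A A' = cart_prod B B'"
  proof
    show sub: "?h ` cart_prod A A' \<subseteq> cart_prod B B'"
      using fB(1) gB lA by (fastforce simp: cart_prod_def)
    show "cart_prod B B' \<subseteq> ?h ` cart_prod A A'"
    proof
      fix z assume "z \<in> cart_prod B B'"
      then obtain x y where z: "z = f x @ g y" "x \<in> A" "y \<in> A'"
        using bf bg by (auto simp: cart_prod_def bij_betw_def)
      then have "z = ?h (x @ y)" "x @ y \<in> cart_prod A A'" using h[OF z(2), of y] by (auto simp: cart_prod_def)
      then show "z \<in> ?h ` cart_prod A A'" by blast
    qed
  qed
  note cA = pp_definable_cart_prod[OF A(1) A'(1)] and cB = pp_definable_cart_prod[OF B B']
  let ?N = "(n + n') + (m + m')"
  let ?S = "{zs. length zs = ?N \<and> map ((!) zs) ([0..<n] @ [n + n'..<n + n' + m]) \<in> graph_on f A} \<inter>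
    {zs. length zs = ?N \<and> map ((!) zs) ([n..<n + n'] @ [n + n' + m..<?N]) \<in> graph_on g A'}"
  have "graph_on ?h (cart_prod A A') = ?S"
  proof (rule append_set_eqI[of _ "n + n'" "m + m'"])
    fix us vs :: "'a list"
    assume len: "length us = n + n'" "length vs = m + m'"
    define xs xs' ys ys' where "xs = take n us" and "xs' = drop n us" and "ys = take m vs" and "ys' = drop m vs"
    then have d: "us = xs @ xs'" "vs = ys @ ys'"
      and l: "length xs = n" "length xs' = n'" "length ys = m" "length ys' = m'"
      using len by auto
    have c: "us \<in> cart_prod A A' \<longleftrightarrow> xs \<in> A \<and> xs' \<in> A'"
      unfolding d by (rule cart_prod_mem[OF A(1) l(1)])
    have v: "vs = ?h us \<longleftrightarrow> ys = f xs \<and> ys' = g xs'" if "xs \<in> A"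
      using append_eq_append_conv[of ys "f xs" ys' "g xs'"] fB(2)[OF that] l(3) h[OF that, of xs']
      unfolding d by metis
    have m1: "map ((!) (us @ vs)) ([0..<n] @ [n + n'..<n + n' + m]) = xs @ ys"
      and m2: "map ((!) (us @ vs)) ([n..<n + n'] @ [n + n' + m..<?N]) = xs' @ ys'"
      using l by (simp_all add: d map_nth_upt)
    have "us @ vs \<in> graph_on ?h (cart_prod A A') \<longleftrightarrow> us \<in> cart_prod A A' \<and> vs = ?h us"
      by (rule graph_on_mem[OF cA len(1)])
    also have "\<dots> \<longleftrightarrow> (xs \<in> A \<and> ys = f xs) \<and> (xs' \<in> A' \<and> ys' = g xs')"
      using c v by blast
    also have "\<dots> \<longleftrightarrow> xs @ ys \<in> graph_on f A \<and> xs' @ ys' \<in> graph_on g A'"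
      unfolding graph_on_mem[OF A(1) l(1)] graph_on_mem[OF A'(1) l(2)] ..
    also have "\<dots> \<longleftrightarrow> us @ vs \<in> ?S"
      unfolding Int_iff mem_Collect_eq m1 m2 using len by simp
    finally show "us @ vs \<in> graph_on ?h (cart_prod A A') \<longleftrightarrow> us @ vs \<in> ?S" .
  qed (auto dest: graph_on_length[OF cA cB equalityD1[OF img]])
  moreover have "pp_definable act ?N ?S"
    by (intro pp_definable_Int pp_definable_reindex[OF Gf] pp_definable_reindex[OF Gg]) auto
  ultimately show ?thesis
    using inj img by (auto simp: pp_bijection_def bij_betw_def)
qed

lemma pp_bijection_swap:
  assumes A: "pp_definable act n A" and B: "pp_definable act m B"
  shows "pp_bijection act (\<lambda>zs. drop n zs @ take n zs) (cart_prod A B) (cart_prod B A)"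
    (is "pp_bijection act ?h _ _")
proof -
  note lA = pp_definable_length[OF A] and lB = pp_definable_length[OF B]
  have bij: "bij_betw ?h (cart_prod A B) (cart_prod B A)"
    by (rule bij_betw_byWitness[where f' = "\<lambda>zs. drop m zs @ take m zs"])
      (use lA lB in \<open>force simp: cart_prod_def\<close>)+
  then have sub: "?h ` cart_prod A B \<subseteq> cart_prod B A" by (simp add: bij_betw_def)
  note cA = pp_definable_cart_prod[OF A B] and cB = pp_definable_cart_prod[OF B A]
  let ?N = "(n + m) + (m + n)"
  let ?S = "{zs. length zs = ?N \<and> map ((!) zs) [0..<n + m] \<in> cart_prod A B} \<inter>
    {zs. length zs = ?N \<and> map ((!) zs) ([n..<n + m] @ [0..<n]) = map ((!) zs) [n + m..<?N]}"
  have "graph_on ?h (cart_prod A B) = ?S"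
    by (rule append_set_eqI[of _ "n + m" "m + n"])
      (auto simp: graph_on_mem[OF cA] map_nth_upt dest: graph_on_length[OF cA cB sub])
  moreover have "pp_definable act ?N ?S"
    by (intro pp_definable_Int pp_definable_reindex[OF cA] pp_definable_eq) auto
  ultimately show ?thesis
    using bij by (auto simp: pp_bijection_def)
qed



lemma equiv_colour_rel: "equiv (nonempty_pp_sets act) (colour_rel act)"
proof (rule equivI)
  show "colour_rel act \<subseteq> nonempty_pp_sets act \<times> nonempty_pp_sets act"
    by (auto simp: colour_rel_def)
  show "refl_on (nonempty_pp_sets act) (colour_rel act)"
    using pp_bijection_id by (fastforce simp: refl_on_def colour_rel_def nonempty_pp_sets_def)
  show "sym (colour_rel act)"
    using pp_bijection_inv by (fastforce simp: sym_def colour_rel_def nonempty_pp_sets_def)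
  show "trans (colour_rel act)"
  proof (rule transI)
    fix A B C assume "(A, B) \<in> colour_rel act" "(B, C) \<in> colour_rel act"
    then show "(A, C) \<in> colour_rel act"
      unfolding colour_rel_def nonempty_pp_sets_def using pp_bijection_comp by blast
  qed
qed

lemma cart_prod_in_nonempty_pp_sets:
  assumes "A \<in> nonempty_pp_sets act" "B \<in> nonempty_pp_sets act"
  shows "cart_prod A B \<in> nonempty_pp_sets act"
proof -
  have "cart_prod A B \<noteq> {}"
    using assms by (auto simp: nonempty_pp_sets_def cart_prod_def)
  then show ?thesis
    using assms pp_definable_cart_prod by (fastforce simp: nonempty_pp_sets_def)
qed

lemma cart_prod_cong:
  assumes "(A, B) \<in> colour_rel act" "(A', B') \<in> colour_rel act"
  shows "(cart_prod A A', cart_prod B B') \<in> colour_rel act"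
proof -
  obtain f g where f: "pp_bijection act f A B" and g: "pp_bijection act g A' B'"
    using assms by (auto simp: colour_rel_def)
  obtain n n' m m' where A: "pp_definable act n A" "A \<noteq> {}" and B: "pp_definable act m B"
    and A': "pp_definable act n' A'" "A' \<noteq> {}" and B': "pp_definable act m' B'"
    using assms by (auto simp: colour_rel_def nonempty_pp_sets_def)
  from pp_bijection_cart_prod[OF f g A B A' B'] show ?thesis
    using assms cart_prod_in_nonempty_pp_sets by (auto simp: colour_rel_def)
qed

lemma congruent2_cart_prod:
  "congruent2 (colour_rel act) (colour_rel act) (\<lambda>A B. colour_rel act `` {cart_prod A B})"
  by (auto simp: congruent2_def intro!: equiv_class_eq[OF equiv_colour_rel] cart_prod_cong)

lemma mult_nontrivial_colours:
  assumes "A \<in> nonempty_pp_sets act" "B \<in> nonempty_pp_sets act"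
  shows "mult (nontrivial_colours act) (colour_rel act `` {A}) (colour_rel act `` {B}) =
    colour_rel act `` {cart_prod A B}"
  using UN_equiv_class2[OF equiv_colour_rel equiv_colour_rel congruent2_cart_prod assms]
  by (simp add: nontrivial_colours_def)

lemma cart_prod_commute:
  assumes "A \<in> nonempty_pp_sets act" "B \<in> nonempty_pp_sets act"
  shows "(cart_prod A B, cart_prod B A) \<in> colour_rel act"
proof -
  obtain n m where "pp_definable act n A" "pp_definable act m B"
    using assms by (auto simp: nonempty_pp_sets_def)
  from pp_bijection_swap[OF this] show ?thesis
    using assms cart_prod_in_nonempty_pp_sets by (auto simp: colour_rel_def)
qed

lemma cart_prod_assoc: "cart_prod (cart_prod A B) C = cart_prod A (cart_prod B C)"
  by (auto simp: cart_prod_def) (metis append_assoc)+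

lemma cart_prod_unit: "cart_prod {[]} A = A"
  by (auto simp: cart_prod_def)

lemma unit_in_nonempty_pp_sets: "{[]} \<in> nonempty_pp_sets act"
proof -
  have "pp_definable act 0 {[]}"
    unfolding pp_definable_def by (rule exI[of _ "PP 0 []"]) auto
  then show ?thesis by (auto simp: nonempty_pp_sets_def)
qed

theorem comm_monoid_nontrivial_colours: "comm_monoid (nontrivial_colours act)"
proof -
  have car: "carrier (nontrivial_colours act) = nonempty_pp_sets act // colour_rel act"
    and one: "one (nontrivial_colours act) = colour_rel act `` {{[]}}"
    by (auto simp: nontrivial_colours_def)
  note m = mult_nontrivial_colours cart_prod_in_nonempty_pp_sets unit_in_nonempty_pp_sets
  show ?thesis
  proof (rule comm_monoidI, unfold car one)
    show "colour_rel act `` {{[]}} \<in> nonempty_pp_sets act // colour_rel act"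
      by (intro quotientI m)
    fix X Y assume "X \<in> nonempty_pp_sets act // colour_rel act" "Y \<in> nonempty_pp_sets act // colour_rel act"
    then obtain A B where AB: "X = colour_rel act `` {A}" "A \<in> nonempty_pp_sets act"
      "Y = colour_rel act `` {B}" "B \<in> nonempty_pp_sets act"
      by (elim quotientE) blast
    then show "mult (nontrivial_colours act) X Y \<in> nonempty_pp_sets act // colour_rel act"
      by (simp add: m quotientI)
    show "mult (nontrivial_colours act) X Y = mult (nontrivial_colours act) Y X"
      using equiv_class_eq[OF equiv_colour_rel cart_prod_commute] AB by (simp add: m)
  qed (auto elim!: quotientE simp: m cart_prod_assoc cart_prod_unit)
qed

end

theory Submission
  imports Defs
begin

text \<open>Every \<open>R\<close>-linear endomorphism \<open>\<phi>\<close> of \<open>M\<close> acts on a pp-definable set \<open>D\<close> by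
  \<open>a, b, c \<in> D \<Longrightarrow> a + \<phi>(b - c) \<in> D\<close>. Over a division ring, endomorphisms move any nonzero vector
  anywhere, so for the projection of \<open>D\<close> forgetting the last coordinate, either all fibres are
  singletons or all fibres are the whole of \<open>M\<close>. By induction on the number of coordinates,
  \<open>D\<close> is therefore in pp-definable bijection with some \<open>M\<^sup>d\<close>. The same dichotomy bounds the length
  of strictly decreasing chains of nonempty pp-definable subsets of \<open>M\<^sup>n\<close> by \<open>n\<close>; as \<open>M\<^sup>n\<close> has
  such a chain of length \<open>n\<close> and pp-definable bijections preserve chains, \<open>d\<close> is unique.\<close>

section \<open>Endomorphisms of vector spaces over a division ring\<close>

definition module_endo :: "('m::ab_group_add \<Rightarrow> 'r \<Rightarrow> 'm) \<Rightarrow> ('m \<Rightarrow> 'm) \<Rightarrow> bool" where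
  "module_endo act \<phi> \<longleftrightarrow>
    (\<forall>x y. \<phi> (x + y) = \<phi> x + \<phi> y) \<and> (\<forall>x r. \<phi> (act x r) = act (\<phi> x) r)"

lemma module_endo_zero:
  assumes "module_endo act \<phi>" shows "\<phi> 0 = 0"
proof -
  have "\<phi> (0 + 0) = \<phi> 0 + \<phi> 0" using assms unfolding module_endo_def by blast
  then show ?thesis by simp
qed

lemma module_endo_minus:
  assumes "module_endo act \<phi>" shows "\<phi> (- x) = - \<phi> x"
proof -
  have "\<phi> (x + - x) = \<phi> x + \<phi> (- x)" using assms unfolding module_endo_def by blast
  then show ?thesis using module_endo_zero[OF assms] by (simp add: eq_neg_iff_add_eq_0 add.commute)
qed

lemma module_endo_diff:
  assumes "module_endo act \<phi>" shows "\<phi> (x - y) = \<phi> x - \<phi> y"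
proof -
  have "\<phi> (x + - y) = \<phi> x + \<phi> (- y)" using assms unfolding module_endo_def by blast
  then show ?thesis using module_endo_minus[OF assms] by simp
qed

definition submodule :: "('m::ab_group_add \<Rightarrow> 'r \<Rightarrow> 'm) \<Rightarrow> 'm set \<Rightarrow> bool" where
  "submodule act N \<longleftrightarrow> 0 \<in> N \<and> (\<forall>x\<in>N. \<forall>y\<in>N. x + y \<in> N) \<and> (\<forall>x\<in>N. \<forall>r. act x r \<in> N)"

context right_module
begin

lemma act_zero_left: "0 \<cdot> r = 0"
  using act_add_left[of 0 0 r] by simp

lemma act_zero_right: "x \<cdot> 0 = 0"
  using act_add_right[of x 0 0] by simp

lemma act_minus_left: "(- x) \<cdot> r = - (x \<cdot> r)"
  using act_add_left[of x "- x" r] by (simp add: act_zero_left eq_neg_iff_add_eq_0 add.commute)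

lemma act_minus_right: "x \<cdot> (- r) = - (x \<cdot> r)"
  using act_add_right[of x r "- r"] by (simp add: act_zero_right eq_neg_iff_add_eq_0 add.commute)

lemma act_diff_left: "(x - y) \<cdot> r = x \<cdot> r - y \<cdot> r"
  using act_add_left[of x "- y" r] by (simp add: act_minus_left)

lemma act_diff_right: "x \<cdot> (r - s) = x \<cdot> r - x \<cdot> s"
  using act_add_right[of x r "- s"] by (simp add: act_minus_right)

text \<open>Negation is the action of \<open>- 1\<close>, so closure under sums and scalars already
  covers differences.\<close>

lemma submodule_diff:
  assumes "submodule act N" "x \<in> N" "y \<in> N"
  shows "x - y \<in> N"
proof -
  have "y \<cdot> (- 1) \<in> N" using assms unfolding submodule_def by blast
  then have "- y \<in> N" by (simp add: act_minus_right act_one)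
  then have "x + - y \<in> N" using assms unfolding submodule_def by blast
  then show ?thesis by simp
qed

text \<open>Zorn's lemma: unions bound the nonempty chains and \<open>{0}\<close> bounds the empty
  one. Over a division ring the resulting \<open>N\<close> is a complement of the line spanned by
  \<open>v\<close>.\<close>

lemma maximal_submodule_avoiding:
  assumes "v \<noteq> 0"
  obtains N where "submodule act N" "v \<notin> N"
    "\<And>N'. submodule act N' \<Longrightarrow> v \<notin> N' \<Longrightarrow> N \<subseteq> N' \<Longrightarrow> N' = N"
proof -
  let ?S = "{N. submodule act N \<and> v \<notin> N}"
  have "\<exists>U\<in>?S. \<forall>X\<in>C. X \<subseteq> U" if C: "subset.chain ?S C" for C
  proof (cases "C = {}")
    case True
    have "submodule act {0}" by (simp add: submodule_def act_zero_left)
    with assms True show ?thesis by blast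
  next
    case False
    have C1: "submodule act X" "v \<notin> X" if "X \<in> C" for X
      using C that by (auto simp: subset_chain_def)
    have C2: "X \<subseteq> Y \<or> Y \<subseteq> X" if "X \<in> C" "Y \<in> C" for X Y
      using C that by (auto simp: subset_chain_def)
    have "x + y \<in> \<Union>C" if xy: "x \<in> \<Union>C" "y \<in> \<Union>C" for x y
    proof -
      from xy obtain X Y where XY: "X \<in> C" "Y \<in> C" "x \<in> X" "y \<in> Y" by blast
      with C2[OF XY(1,2)] obtain Z where "Z \<in> C" "x \<in> Z" "y \<in> Z" by blast
      with C1(1) show ?thesis unfolding submodule_def by blast
    qed
    then have "submodule act (\<Union>C)"
      using False C1(1) unfolding submodule_def by blast
    with C1(2) show ?thesis by blast
  qed
  from subset_Zorn[OF this] obtain N where "N \<in> ?S" "\<forall>X\<in>?S. N \<subseteq> X \<longrightarrow> X = N" by blast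
  then show thesis using that by blast
qed

end

locale right_vector_space = right_module act
  for act :: "'m::ab_group_add \<Rightarrow> 'r::division_ring \<Rightarrow> 'm"  (infixl \<open>\<cdot>\<close> 75)
begin

text \<open>If \<open>x\<close> lies outside a maximal \<open>N\<close> avoiding \<open>v\<close>,
  then \<open>v\<close> lies in the sum of \<open>N\<close> and the line of \<open>x\<close>. The
  coefficient of \<open>x\<close> is nonzero there, so dividing by it solves for \<open>x\<close>
  modulo \<open>N\<close>. Uniqueness follows by dividing by \<open>r - s\<close>.\<close>

lemma hyperplane_complement:
  assumes "v \<noteq> 0"
  obtains N where "submodule act N" "\<And>x. \<exists>!r. x - v \<cdot> r \<in> N"
proof -
  obtain N where N: "submodule act N" "v \<notin> N"
    and max: "\<And>N'. submodule act N' \<Longrightarrow> v \<notin> N' \<Longrightarrow> N \<subseteq> N' \<Longrightarrow> N' = N"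
    using maximal_submodule_avoiding[OF assms] by metis
  have scal: "y \<cdot> r \<in> N" if "y \<in> N" for y r
    using N(1) that unfolding submodule_def by blast
  have ex: "\<exists>r. x - v \<cdot> r \<in> N" for x
  proof (cases "x \<in> N")
    case True
    then show ?thesis by (intro exI[of _ 0]) (simp add: act_zero_right)
  next
    case False
    \<comment> \<open>The sum of \<open>N\<close> and the line of \<open>x\<close>; it properly
      contains \<open>N\<close>, so maximality forces \<open>v\<close> into it.\<close>
    let ?N' = "{y. \<exists>r. y - x \<cdot> r \<in> N}"
    have "submodule act ?N'"
      unfolding submodule_def mem_Collect_eq
    proof (intro conjI ballI allI)
      show "\<exists>r. 0 - x \<cdot> r \<in> N"
        using N(1) by (intro exI[of _ 0]) (simp add: act_zero_right submodule_def)
      fix y s assume "y \<in> ?N'"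
      then obtain r where r: "y - x \<cdot> r \<in> N" by blast
      then have "(y - x \<cdot> r) \<cdot> s \<in> N" by (rule scal)
      then show "\<exists>r. y \<cdot> s - x \<cdot> r \<in> N" by (auto simp: act_diff_left act_mult[symmetric])
      fix z assume "z \<in> ?N'"
      then obtain r' where "z - x \<cdot> r' \<in> N" by blast
      with r have "(y - x \<cdot> r) + (z - x \<cdot> r') \<in> N" using N(1) unfolding submodule_def by blast
      moreover have "(y - x \<cdot> r) + (z - x \<cdot> r') = y + z - x \<cdot> (r + r')"
        by (simp add: act_add_right algebra_simps)
      ultimately show "\<exists>r. y + z - x \<cdot> r \<in> N" by metis
    qed
    moreover have "N \<subseteq> ?N'"
    proof
      fix y assume "y \<in> N"
      then have "y - x \<cdot> 0 \<in> N" by (simp add: act_zero_right)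
      then show "y \<in> ?N'" by blast
    qed
    moreover have "x - x \<cdot> 1 \<in> N" using N(1) by (simp add: act_one submodule_def)
    then have "x \<in> ?N'" by blast
    ultimately have "v \<in> ?N'" using max False by blast
    then obtain r where r: "v - x \<cdot> r \<in> N" by blast
    then have "r \<noteq> 0" using N(2) by (auto simp: act_zero_right)
    then have "(v - x \<cdot> r) \<cdot> inverse r = v \<cdot> inverse r - x"
      by (simp add: act_diff_left act_mult[symmetric] act_one)
    with scal[OF r] have "v \<cdot> inverse r - x \<in> N" by metis
    moreover have "0 \<in> N" using N(1) by (simp add: submodule_def)
    ultimately have "0 - (v \<cdot> inverse r - x) \<in> N" using submodule_diff[OF N(1)] by blast
    then show ?thesis by auto
  qed
  have "r = s" if rs: "x - v \<cdot> r \<in> N" "x - v \<cdot> s \<in> N" for x r s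
  proof (rule ccontr)
    assume "r \<noteq> s"
    have "(x - v \<cdot> s) - (x - v \<cdot> r) \<in> N" by (rule submodule_diff[OF N(1) rs(2,1)])
    then have "v \<cdot> (r - s) \<in> N" by (simp add: act_diff_right)
    then have "v \<cdot> (r - s) \<cdot> inverse (r - s) \<in> N" by (rule scal)
    with \<open>r \<noteq> s\<close> N(2) show False by (simp add: act_mult[symmetric] act_one)
  qed
  with ex N(1) show thesis using that by blast
qed

text \<open>The \<open>v\<close>-coordinate along a complement of the line of \<open>v\<close> is a
  right-linear functional \<open>c\<close>; the map \<open>x \<mapsto> w \<cdot> c x\<close> is
  linear because scalars multiply on the right throughout.\<close>

lemma ex_module_endo:
  assumes "v \<noteq> 0"
  obtains \<phi> where "module_endo act \<phi>" "\<phi> v = w"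
proof -
  obtain N where N: "submodule act N" and ex1: "\<And>x. \<exists>!r. x - v \<cdot> r \<in> N"
    using hyperplane_complement[OF assms] by metis
  define c where "c x = (THE r. x - v \<cdot> r \<in> N)" for x
  have c: "x - v \<cdot> c x \<in> N" for x
    unfolding c_def by (rule theI') (rule ex1)
  have cI: "c x = r" if "x - v \<cdot> r \<in> N" for x r
    using ex1 c that by blast
  have "c (x + y) = c x + c y" for x y
  proof (rule cI)
    have "(x - v \<cdot> c x) + (y - v \<cdot> c y) \<in> N" using c N unfolding submodule_def by blast
    then show "x + y - v \<cdot> (c x + c y) \<in> N" by (simp add: act_add_right algebra_simps)
  qed
  moreover have "c (x \<cdot> r) = c x * r" for x r
  proof (rule cI)
    have "(x - v \<cdot> c x) \<cdot> r \<in> N" using c N unfolding submodule_def by blast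
    then show "x \<cdot> r - v \<cdot> (c x * r) \<in> N" by (simp add: act_diff_left act_mult)
  qed
  ultimately have "module_endo act (\<lambda>x. w \<cdot> c x)"
    by (simp add: module_endo_def act_add_right act_mult)
  moreover have "c v = 1"
    using N by (intro cI) (simp add: act_one submodule_def)
  then have "w \<cdot> c v = w" by (simp add: act_one)
  ultimately show thesis using that by blast
qed

end

section \<open>Fibres of pp-definable sets\<close>

text \<open>A nonempty set pp-definable with parameters is a coset of a subgroup invariant under
  endomorphisms, and such cosets are closed under this operation.\<close>

definition endo_comb ::
  "('m::ab_group_add \<Rightarrow> 'm) \<Rightarrow> 'm list \<Rightarrow> 'm list \<Rightarrow> 'm list \<Rightarrow> 'm list" where
  "endo_comb \<phi> as bs cs = map (\<lambda>i. as ! i + \<phi> (bs ! i - cs ! i)) [0..<length as]"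

text \<open>Terms are affine in their variables: parameters cancel in the difference and survive
  once through \<open>as\<close>, while \<open>\<phi>\<close> commutes with sums, negation and the
  action.\<close>

lemma (in right_module) term_val_endo_comb:
  assumes "module_endo act \<phi>" "term_over n k t" "length as = n" "length as' = k"
  shows "term_val act (endo_comb \<phi> as bs cs) (endo_comb \<phi> as' bs' cs') t =
    term_val act as as' t + \<phi> (term_val act bs bs' t - term_val act cs cs' t)"
  using assms(2)
proof (induction t)
  case (Plus s t)
  have add: "\<phi> (x + y) = \<phi> x + \<phi> y" for x y
    using assms(1) unfolding module_endo_def by blast
  show ?case
    using Plus by (simp add: module_endo_diff[OF assms(1)] add)
next
  case (Act t r)
  have act: "\<phi> (x \<cdot> r) = \<phi> x \<cdot> r" for x
    using assms(1) unfolding module_endo_def by blast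
  show ?case
    using Act by (simp add: module_endo_diff[OF assms(1)] act_add_left act_diff_left act)
qed (use assms in \<open>simp_all add: endo_comb_def module_endo_zero module_endo_diff module_endo_minus\<close>)

text \<open>Combining the existential witnesses in the same way as the points turns each equation
  into the combination of three valid equations.\<close>

lemma (in right_module) pp_definable_endo_comb:
  assumes "module_endo act \<phi>" "pp_definable act n D" "as \<in> D" "bs \<in> D" "cs \<in> D"
  shows "endo_comb \<phi> as bs cs \<in> D"
proof -
  obtain k eqs where over: "\<forall>(s, t) \<in> set eqs. term_over n k s \<and> term_over n k t"
    and D: "D = {xs. length xs = n \<and> (\<exists>ys. length ys = k \<and>
            (\<forall>(s, t) \<in> set eqs. term_val act xs ys s = term_val act xs ys t))}"
    using assms(2) unfolding pp_definable_iff by blast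
  obtain as' where a: "length as = n" "length as' = k"
    "\<forall>(s, t) \<in> set eqs. term_val act as as' s = term_val act as as' t"
    using assms(3) unfolding D by blast
  obtain bs' where b: "\<forall>(s, t) \<in> set eqs. term_val act bs bs' s = term_val act bs bs' t"
    using assms(4) unfolding D by blast
  obtain cs' where c: "\<forall>(s, t) \<in> set eqs. term_val act cs cs' s = term_val act cs cs' t"
    using assms(5) unfolding D by blast
  have "term_val act (endo_comb \<phi> as bs cs) (endo_comb \<phi> as' bs' cs') s =
      term_val act (endo_comb \<phi> as bs cs) (endo_comb \<phi> as' bs' cs') t"
    if "(s, t) \<in> set eqs" for s t
  proof -
    have "term_over n k s" "term_over n k t" using over that by auto
    then show ?thesis
      using a b c that by (fastforce simp: term_val_endo_comb[OF assms(1) _ a(1,2)])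
  qed
  moreover have "length (endo_comb \<phi> as bs cs) = n" "length (endo_comb \<phi> as' bs' cs') = k"
    using a by (simp_all add: endo_comb_def)
  ultimately show ?thesis unfolding D by blast
qed

text \<open>Two points over the same base \<open>zs\<close> differ only in the last coordinate, so
  only that coordinate of \<open>xs @ [a]\<close> moves.\<close>

lemma endo_comb_snoc:
  assumes "\<phi> 0 = 0" "length xs = length zs"
  shows "endo_comb \<phi> (xs @ [a]) (zs @ [b]) (zs @ [c]) = xs @ [a + \<phi> (b - c)]"
  using assms by (intro nth_equalityI) (auto simp: endo_comb_def nth_append less_Suc_eq)

text \<open>Two distinct points in one fibre give a nonzero vector \<open>b - c\<close>; an
  endomorphism sending it to \<open>y - a\<close> moves \<open>xs @ [a]\<close> to
  \<open>xs @ [y]\<close> inside \<open>D\<close>.\<close>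

lemma (in right_vector_space) pp_definable_fibre_full:
  assumes D: "pp_definable act (Suc n) D"
    and "zs @ [b] \<in> D" "zs @ [c] \<in> D" "b \<noteq> c" "xs @ [a] \<in> D"
  shows "xs @ [y] \<in> D"
proof -
  obtain \<phi> where \<phi>: "module_endo act \<phi>" "\<phi> (b - c) = y - a"
    using ex_module_endo[of "b - c" "y - a"] \<open>b \<noteq> c\<close> by auto
  have "length xs = length zs"
    using pp_definable_length[OF D assms(2)] pp_definable_length[OF D assms(5)] by simp
  then have "endo_comb \<phi> (xs @ [a]) (zs @ [b]) (zs @ [c]) = xs @ [y]"
    using endo_comb_snoc[of \<phi> xs zs a b c] module_endo_zero[OF \<phi>(1)] \<phi>(2) by simp
  then show ?thesis
    using pp_definable_endo_comb[OF \<phi>(1) D assms(5,2,3)] by simp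
qed

lemma mem_butlast_image_iff:
  assumes "pp_definable act (Suc n) D"
  shows "xs \<in> butlast ` D \<longleftrightarrow> (\<exists>y. xs @ [y] \<in> D)"
proof
  assume "xs \<in> butlast ` D"
  then obtain zs where zs: "zs \<in> D" "xs = butlast zs" by blast
  then have "zs \<noteq> []" using pp_definable_length[OF assms] by fastforce
  then have "xs @ [last zs] = zs" using zs by simp
  then show "\<exists>y. xs @ [y] \<in> D" using zs by metis
qed force

lemma pp_definable_butlast:
  assumes "pp_definable act (Suc n) D"
  shows "pp_definable act n (butlast ` D)"
proof -
  have "length xs = n" if "xs @ [y] \<in> D" for xs y
    using pp_definable_length[OF assms that] by simp
  moreover have "(\<exists>zs. length zs = 1 \<and> xs @ zs \<in> D) \<longleftrightarrow> (\<exists>y. xs @ [y] \<in> D)" for xs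
    by (metis One_nat_def length_0_conv length_Suc_conv)
  ultimately have "butlast ` D = {xs. length xs = n \<and> (\<exists>zs. length zs = 1 \<and> xs @ zs \<in> D)}"
    using mem_butlast_image_iff[OF assms] by blast
  then show ?thesis using pp_definable_proj[of act n 1 D] assms by simp
qed

text \<open>The dichotomy: failure of injectivity is a fibre with two points, which makes every
  fibre over the projection full.\<close>

lemma (in right_vector_space) snoc_mem_of_not_inj_on_butlast:
  assumes D: "pp_definable act (Suc n) D" and "\<not> inj_on butlast D" "xs \<in> butlast ` D"
  shows "xs @ [y] \<in> D"
proof -
  obtain u v where uv: "u \<in> D" "v \<in> D" "u \<noteq> v" "butlast u = butlast v"
    using assms(2) by (auto simp: inj_on_def)
  then have "u \<noteq> []" "v \<noteq> []" using pp_definable_length[OF D] by fastforce+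
  then have "butlast u @ [last u] = u" "butlast u @ [last v] = v"
    using append_butlast_last_id uv(4) by metis+
  moreover from this have "last u \<noteq> last v" using uv by metis
  moreover obtain a where "xs @ [a] \<in> D"
    using assms(3) mem_butlast_image_iff[OF D] by blast
  ultimately show ?thesis
    using pp_definable_fibre_full[OF D] uv by metis
qed

section \<open>Classification up to pp-definable bijection\<close>

abbreviation module_power :: "nat \<Rightarrow> 'm list set" where
  "module_power d \<equiv> {xs. length xs = d}"

lemma pp_definable_module_power: "pp_definable act d (module_power d)"
  unfolding pp_definable_def by (rule exI[of _ "PP 0 []"]) auto

lemma module_power_in_nonempty_pp_sets:
  "(module_power d :: 'm::ab_group_add list set) \<in> nonempty_pp_sets act"
proof -
  have "replicate d 0 \<in> (module_power d :: 'm list set)" by simp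
  then have "(module_power d :: 'm list set) \<noteq> {}" by blast
  then show ?thesis
    using pp_definable_module_power[of act d] unfolding nonempty_pp_sets_def by blast
qed

lemma cart_prod_module_power: "cart_prod (module_power d) (module_power e) = module_power (d + e)"
proof (rule append_set_eqI[of _ d e])
  fix xs ys :: "'a list"
  assume "length xs = d" "length ys = e"
  then show "xs @ ys \<in> cart_prod (module_power d) (module_power e) \<longleftrightarrow> xs @ ys \<in> module_power (d + e)"
    by (auto simp: cart_prod_def)
qed (auto simp: cart_prod_def)

lemma pp_bijection_butlast:
  assumes D: "pp_definable act (Suc n) D" and inj: "inj_on butlast D"
  shows "pp_bijection act butlast D (butlast ` D)"
proof -
  let ?N = "Suc n + n"
  \<comment> \<open>Coordinate \<open>n\<close>, the one that \<open>butlast\<close> drops, is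
    skipped in the equality.\<close>
  let ?S = "{zs. length zs = ?N \<and> map ((!) zs) [0..<Suc n] \<in> D} \<inter>
    {zs. length zs = ?N \<and> map ((!) zs) [0..<n] = map ((!) zs) [Suc n..<?N]}"
  have "graph_on butlast D = ?S"
  proof (rule append_set_eqI[of _ "Suc n" n])
    fix us vs :: "'a list"
    assume len: "length us = Suc n" "length vs = n"
    then have "map ((!) (us @ vs)) [0..<Suc n] = us"
      "map ((!) (us @ vs)) [0..<n] = butlast us" "map ((!) (us @ vs)) [Suc n..<?N] = vs"
      by (simp_all add: map_nth_upt butlast_conv_take del: upt_Suc)
    then show "us @ vs \<in> graph_on butlast D \<longleftrightarrow> us @ vs \<in> ?S"
      unfolding graph_on_mem[OF D len(1)] Int_iff mem_Collect_eq using len by auto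
  qed (auto dest: graph_on_length[OF D pp_definable_butlast[OF D] subset_refl])
  moreover have "pp_definable act ?N ?S"
    by (intro pp_definable_Int pp_definable_reindex[OF D] pp_definable_eq) auto
  ultimately show ?thesis
    using inj by (auto simp: pp_bijection_def bij_betw_def)
qed

text \<open>Dropping the last coordinate keeps the exponent when the projection is injective and
  lowers it by one when the fibres are full.\<close>

lemma (in right_vector_space) colour_rel_module_power:
  assumes "pp_definable act n D" "D \<noteq> {}"
  shows "\<exists>d. (D, module_power d) \<in> colour_rel act"
  using assms
proof (induction n arbitrary: D)
  case 0
  then have "D = module_power 0" using pp_definable_length[OF 0(1)] by auto
  then have "(D, module_power 0) \<in> colour_rel act"
    using equiv_class_self[OF equiv_colour_rel module_power_in_nonempty_pp_sets[of 0 act]]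
    by (simp only: Image_singleton_iff)
  then show ?case ..
next
  case (Suc n)
  note D = Suc.prems(1) and B = pp_definable_butlast[OF Suc.prems(1)]
  have ne: "D \<in> nonempty_pp_sets act" "butlast ` D \<in> nonempty_pp_sets act"
    using D B Suc.prems(2) by (auto simp: nonempty_pp_sets_def)
  obtain d where d: "(butlast ` D, module_power d) \<in> colour_rel act"
    using Suc.IH[OF B] Suc.prems(2) by auto
  show ?case
  proof (cases "inj_on butlast D")
    case True
    then have "(D, butlast ` D) \<in> colour_rel act"
      using pp_bijection_butlast[OF D] ne by (auto simp: colour_rel_def)
    then have "(D, module_power d) \<in> colour_rel act"
      using d equiv_colour_rel by (metis equivE transD)
    then show ?thesis ..
  next
    case False
    \<comment> \<open>Full fibres make \<open>D\<close> a cylinder over its projection.\<close>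
    have "D = cart_prod (butlast ` D) (module_power 1)"
    proof (rule append_set_eqI[of _ n 1])
      fix xs ys :: "'m list"
      assume len: "length xs = n" "length ys = 1"
      then obtain y where "ys = [y]" by (auto simp: length_Suc_conv)
      then show "xs @ ys \<in> D \<longleftrightarrow> xs @ ys \<in> cart_prod (butlast ` D) (module_power 1)"
        using snoc_mem_of_not_inj_on_butlast[OF D False] mem_butlast_image_iff[OF D]
        unfolding cart_prod_mem[OF B len(1)] by auto
    qed (use pp_definable_length[OF D] cart_prod_length[OF B pp_definable_module_power[of act 1]] in auto)
    moreover have "(module_power 1, module_power 1) \<in> colour_rel act"
      using equiv_class_self[OF equiv_colour_rel module_power_in_nonempty_pp_sets[of 1 act]]
      by (simp only: Image_singleton_iff)
    ultimately have "(D, module_power (d + 1)) \<in> colour_rel act"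
      using cart_prod_cong[OF d] cart_prod_module_power by metis
    then show ?thesis ..
  qed
qed

section \<open>Chains and the uniqueness of the exponent\<close>

text \<open>Counts the coordinates with full fibres, which is the exponent found by the induction in
  \<open>colour_rel_module_power\<close>. It is read off from the coordinates, so its invariance
  under pp-definable bijections is not evident; chains get around this.\<close>

primrec pp_dim :: "nat \<Rightarrow> 'm list set \<Rightarrow> nat" where
  "pp_dim 0 D = 0"
| "pp_dim (Suc n) D = pp_dim n (butlast ` D) + (if inj_on butlast D then 0 else 1)"

lemma pp_dim_le: "pp_dim n D \<le> n"
  by (induction n arbitrary: D) (auto simp: le_SucI)

text \<open>Subsets inherit injectivity of \<open>butlast\<close>, so no coordinate counts more for
  \<open>D\<close> than for \<open>D'\<close>. If the projections differ, induction gives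
  strictness; if they agree, the last coordinate counts for \<open>D'\<close> only.\<close>

lemma (in right_vector_space) pp_dim_strict_mono:
  assumes "pp_definable act n D" "pp_definable act n D'" "D \<noteq> {}" "D \<subset> D'"
  shows "pp_dim n D < pp_dim n D'"
  using assms
proof (induction n arbitrary: D D')
  case 0
  then show ?case
    using pp_definable_length[OF 0(1)] pp_definable_length[OF 0(2)] by fastforce
next
  case (Suc n)
  note D = Suc.prems(1) and D' = Suc.prems(2)
  have flag: "inj_on butlast D" if "inj_on butlast D'"
    using that Suc.prems(4) by (auto intro: inj_on_subset)
  have sub: "butlast ` D \<subseteq> butlast ` D'" using Suc.prems(4) by blast
  show ?case
  proof (cases "butlast ` D = butlast ` D'")
    case False
    then have "pp_dim n (butlast ` D) < pp_dim n (butlast ` D')"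
      using Suc.IH[OF pp_definable_butlast[OF D] pp_definable_butlast[OF D']] sub Suc.prems(3) by auto
    then show ?thesis using flag by auto
  next
    case True
    \<comment> \<open>The base of \<open>z\<close> lies under \<open>D\<close>. Full fibres of
      \<open>D\<close> would contain \<open>z\<close>, so \<open>butlast\<close> is injective on
      \<open>D\<close>; a point of \<open>D\<close> over that base together with \<open>z\<close>
      refutes injectivity on \<open>D'\<close>.\<close>
    obtain z where z: "z \<in> D'" "z \<notin> D" using Suc.prems(4) by blast
    then have "z \<noteq> []" using pp_definable_length[OF D'] by fastforce
    then have z': "butlast z @ [last z] = z" by simp
    have bz: "butlast z \<in> butlast ` D" using True z by blast
    have "inj_on butlast D"
      using snoc_mem_of_not_inj_on_butlast[OF D _ bz, of "last z"] z z' by auto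
    moreover have "\<not> inj_on butlast D'"
    proof
      assume inj: "inj_on butlast D'"
      obtain u where "u \<in> D" "butlast u = butlast z" using bz by auto
      with inj z Suc.prems(4) show False by (metis inj_onD psubsetD)
    qed
    ultimately show ?thesis using True by simp
  qed
qed

text \<open>The second number counts strict inclusions, so a chain has one more member than that.
  The bottom must be nonempty, which makes the bound \<open>n\<close> instead of
  \<open>n + 1\<close>.\<close>

inductive pp_chain :: "('m::ab_group_add \<Rightarrow> 'r \<Rightarrow> 'm) \<Rightarrow> nat \<Rightarrow> nat \<Rightarrow> 'm list set \<Rightarrow> bool"
  for act n where
  base: "pp_definable act n D \<Longrightarrow> D \<noteq> {} \<Longrightarrow> pp_chain act n 0 D"
| step: "pp_definable act n D \<Longrightarrow> pp_chain act n k D' \<Longrightarrow> D' \<subset> D \<Longrightarrow> pp_chain act n (Suc k) D"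

lemma pp_chain_pp_definable: "pp_chain act n k D \<Longrightarrow> pp_definable act n D \<and> D \<noteq> {}"
  by (induction rule: pp_chain.induct) auto

text \<open>Each strict inclusion raises \<open>pp_dim\<close> by at least one, and
  \<open>pp_dim n\<close> never exceeds \<open>n\<close>.\<close>

lemma (in right_vector_space) pp_chain_le:
  assumes "pp_chain act n k D"
  shows "k \<le> n"
proof -
  from assms have "k \<le> pp_dim n D"
  proof (induction rule: pp_chain.induct)
    case (step D k D')
    then show ?case
      using pp_dim_strict_mono[of n D' D] pp_chain_pp_definable[OF step(2)] by auto
  qed simp
  then show ?thesis using pp_dim_le le_trans by blast
qed

section \<open>Transport of chains along pp-definable bijections\<close>

lemma pp_definable_image:
  assumes f: "pp_bijection act f A B" and A: "pp_definable act n A" and B: "pp_definable act m B"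
    and A': "pp_definable act n A'" "A' \<subseteq> A" "A' \<noteq> {}"
  shows "pp_definable act m (f ` A')"
proof -
  have "A \<noteq> {}" using A' by blast
  note G = pp_bijection_graph[OF f A B this]
  have fB: "f x \<in> B" if "x \<in> A" for x
    using f that by (auto simp: pp_bijection_def bij_betw_def)
  \<comment> \<open>The part of the graph over \<open>A'\<close>, with image coordinates first
    because \<open>pp_definable_proj\<close> forgets the trailing ones.\<close>
  define H where "H =
    {us. length us = m + n \<and> map ((!) us) ([m..<m + n] @ [0..<m]) \<in> graph_on f A} \<inter>
    {us. length us = m + n \<and> map ((!) us) [m..<m + n] \<in> A'}"
  have H: "pp_definable act (m + n) H"
    unfolding H_def by (intro pp_definable_Int pp_definable_reindex[OF G] pp_definable_reindex[OF A'(1)]) auto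
  have mem: "ys @ xs \<in> H \<longleftrightarrow> xs \<in> A' \<and> ys = f xs" if "length ys = m" "length xs = n" for xs ys
    using that A'(2) by (auto simp: H_def map_nth_upt graph_on_mem[OF A])
  have "f ` A' = {ys. length ys = m \<and> (\<exists>xs. length xs = n \<and> ys @ xs \<in> H)}"
  proof (intro Set.set_eqI iffI)
    fix ys assume "ys \<in> f ` A'"
    then obtain xs where xs: "xs \<in> A'" "ys = f xs" by blast
    moreover from this have "length xs = n" "length ys = m"
      using pp_definable_length[OF A'(1)] pp_definable_length[OF B] fB A'(2) by auto
    ultimately show "ys \<in> {ys. length ys = m \<and> (\<exists>xs. length xs = n \<and> ys @ xs \<in> H)}"
      using mem by blast
  qed (use mem in auto)
  with pp_definable_proj[OF H] show ?thesis by simp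
qed

text \<open>Injectivity keeps the inclusions strict. The length \<open>k\<close> survives while the
  ambient power changes from \<open>n\<close> to \<open>m\<close>, so the bound for \<open>m\<close>
  applies to chains coming from \<open>n\<close>.\<close>

lemma pp_chain_image:
  assumes f: "pp_bijection act f A B" and A: "pp_definable act n A" and B: "pp_definable act m B"
    and "pp_chain act n k D" "D \<subseteq> A"
  shows "pp_chain act m k (f ` D)"
  using assms(4,5)
proof (induction rule: pp_chain.induct)
  case (base D)
  then show ?case using pp_definable_image[OF f A B] by (auto intro: pp_chain.base)
next
  case (step D k D')
  have "inj_on f D"
    using f step.prems by (auto simp: pp_bijection_def bij_betw_def intro: inj_on_subset)
  with step.hyps(3) have "f ` D' \<subset> f ` D" by (metis inj_on_image_eq_iff psubset_eq subset_refl image_mono)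
  moreover have "D \<noteq> {}" using step.hyps(3) by blast
  ultimately show ?case
    using step pp_definable_image[OF f A B step.hyps(1) step.prems] by (blast intro: pp_chain.step)
qed

section \<open>A chain of full length in every power of the module\<close>

lemma pp_definable_Cons_zero:
  assumes "pp_definable act n D"
  shows "pp_definable act (Suc n) ((#) 0 ` D)"
proof -
  have "pp_definable act 1 {[0]}"
    unfolding pp_definable_def
    by (rule exI[of _ "PP 0 [(Free 0, Zero)]"]) (auto simp: length_Suc_conv)
  from pp_definable_cart_prod[OF this assms] have "pp_definable act (Suc n) (cart_prod {[0]} D)" by simp
  moreover have "cart_prod {[0]} D = (#) 0 ` D" by (auto simp: cart_prod_def)
  ultimately show ?thesis by simp
qed

lemma pp_chain_Cons_zero:
  assumes "pp_chain act n k D"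
  shows "pp_chain act (Suc n) k ((#) 0 ` D)"
  using assms
proof (induction rule: pp_chain.induct)
  case (base D)
  then show ?case by (auto intro: pp_chain.base pp_definable_Cons_zero)
next
  case (step D k D')
  then have "(#) 0 ` D' \<subset> (#) 0 ` D" by blast
  then show ?case using step by (blast intro: pp_chain.step pp_definable_Cons_zero)
qed

text \<open>Coordinate subspaces: the chain for \<open>d\<close> is placed in the hyperplane of
  vectors with first coordinate \<open>0\<close>, and \<open>v # replicate d 0\<close> lies outside
  it.\<close>

lemma pp_chain_module_power:
  fixes act :: "'m::ab_group_add \<Rightarrow> 'r \<Rightarrow> 'm" and v :: 'm
  assumes "v \<noteq> 0"
  shows "pp_chain act d d (module_power d)"
proof (induction d)
  case 0
  show ?case by (auto intro: pp_chain.base pp_definable_module_power[of act 0, simplified])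
next
  case (Suc d)
  have "v # replicate d 0 \<in> module_power (Suc d)" "v # replicate d 0 \<notin> (#) 0 ` module_power d"
    using assms by auto
  then have "(#) 0 ` module_power d \<subset> (module_power (Suc d) :: 'm list set)" by auto
  then show ?case
    by (rule pp_chain.step[OF pp_definable_module_power pp_chain_Cons_zero[OF Suc]])
qed

text \<open>A bijection carries the chain of length \<open>d\<close> into the power
  \<open>e\<close>, where chains have length at most \<open>e\<close>.\<close>

lemma (in right_vector_space) colour_rel_module_power_le:
  assumes "(v :: 'm) \<noteq> 0" "(module_power d, module_power e) \<in> colour_rel act"
  shows "d \<le> e"
proof -
  obtain f where "pp_bijection act f (module_power d) (module_power e)"
    using assms(2) by (auto simp: colour_rel_def)
  from pp_chain_image[OF this pp_definable_module_power pp_definable_module_power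
      pp_chain_module_power[OF assms(1)] subset_refl]
  show ?thesis by (rule pp_chain_le)
qed

section \<open>The isomorphism with the natural numbers\<close>

theorem theorem3p4:
  fixes act :: "'m::ab_group_add \<Rightarrow> 'r::division_ring \<Rightarrow> 'm"
  assumes "right_module act"
    and "infinite (UNIV :: 'm set)"
  shows "nontrivial_colours act \<cong> \<lparr>carrier = UNIV, mult = (+), one = 0 :: nat\<rparr>"
proof -
  interpret right_vector_space act
    using assms(1) by (simp add: right_vector_space_def)
  \<comment> \<open>Infinitude of the module supplies the nonzero vector behind the chains of full
    length.\<close>
  obtain v :: 'm where v: "v \<noteq> 0"
    using assms(2) finite_subset[of UNIV "{0 :: 'm}"] by auto
  let ?M = "nontrivial_colours act" and ?N = "\<lparr>carrier = UNIV, mult = (+), one = 0 :: nat\<rparr>"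
  \<comment> \<open>The map is built from the numbers to the colours, where it is explicit; its
    inverse is the isomorphism required.\<close>
  define h where "h d = colour_rel act `` {module_power d}" for d
  have mult: "mult ?M (h d) (h e) = h (d + e)" for d e
    unfolding h_def
    by (simp only: mult_nontrivial_colours[OF module_power_in_nonempty_pp_sets module_power_in_nonempty_pp_sets]
        cart_prod_module_power)
  have "inj h"
  proof (rule injI)
    fix d e assume "h d = h e"
    then have "(module_power d, module_power e) \<in> colour_rel act"
      unfolding h_def by (rule eq_equiv_class[OF _ equiv_colour_rel module_power_in_nonempty_pp_sets])
    moreover from this have "(module_power e, module_power d) \<in> colour_rel act"
      using equiv_colour_rel by (metis equivE symD)
    \<comment> \<open>The chain bound is applied in both directions.\<close>
    ultimately show "d = e"
      by (intro order_antisym colour_rel_module_power_le[OF v])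
  qed
  moreover have "range h = carrier ?M"
  proof
    show "range h \<subseteq> carrier ?M"
    proof
      fix X assume "X \<in> range h"
      then obtain d where "X = h d" by blast
      then have "X \<in> nonempty_pp_sets act // colour_rel act"
        unfolding h_def by (simp only: quotientI[OF module_power_in_nonempty_pp_sets])
      then show "X \<in> carrier ?M" by (simp add: nontrivial_colours_def)
    qed
    show "carrier ?M \<subseteq> range h"
    proof
      fix X assume "X \<in> carrier ?M"
      then have "X \<in> nonempty_pp_sets act // colour_rel act" by (simp add: nontrivial_colours_def)
      then obtain D where D: "X = colour_rel act `` {D}" "D \<in> nonempty_pp_sets act"
        by (rule quotientE)
      from D(2) obtain d where "(D, module_power d) \<in> colour_rel act"
        using colour_rel_module_power unfolding nonempty_pp_sets_def by blast
      then have "X = h d" unfolding D(1) h_def by (rule equiv_class_eq[OF equiv_colour_rel])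
      then show "X \<in> range h" by blast
    qed
  qed
  ultimately have bij: "bij_betw h UNIV (carrier ?M)" by (simp add: bij_betw_def)
  have "inv_into UNIV h \<in> iso ?M ?N"
  proof (rule isoI)
    show "inv_into UNIV h \<in> hom ?M ?N"
    proof (rule homI)
      fix X Y assume "X \<in> carrier ?M" "Y \<in> carrier ?M"
      then have "X \<in> range h" "Y \<in> range h"
        unfolding bij_betw_imp_surj_on[OF bij] .
      then obtain d e where "X = h d" "Y = h e" by (elim rangeE)
      then show "inv_into UNIV h (mult ?M X Y) = mult ?N (inv_into UNIV h X) (inv_into UNIV h Y)"
        by (simp add: mult inv_f_f[OF \<open>inj h\<close>])
    qed simp
    show "bij_betw (inv_into UNIV h) (carrier ?M) (carrier ?N)"
      using bij_betw_inv_into[OF bij] by simp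
  qed
  then show ?thesis by (auto simp: is_iso_def)
qed

end
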